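(* Let $\beta,\gamma,\delta>0$ with $\beta>\gamma+\delta$, let $\alpha=\beta-\gamma-\delta>0$, and let $x,y,z\in(0,1)$. Let $U_{00},U_{01},U_{10},U_{11}$ be the means and $P,Q,R,S,T,V$ the propositions defined in the context, and assume that all of $U_{00},U_{01},U_{10},U_{11}$ lie in $(0,1)$. Then $$\max\{\sin^{\alpha}(\pi U_{00}),\sin^{\alpha}(\pi U_{01}),\sin^{\alpha}(\pi U_{10}),\sin^{\alpha}(\pi U_{11})\}=\begin{cases}\sin^{\alpha}(\pi U_{00}),&\text{if }P,\ Q,\ T\text{ hold},\\ \sin^{\alpha}(\pi U_{01}),&\text{if }\neg P,\ R,\ V\text{ hold},\\ \sin^{\alpha}(\pi U_{10}),&\text{if }\neg Q,\ S,\ \neg V\text{ hold},\\ \sin^{\alpha}(\pi U_{11}),&\text{if }\neg R,\ \neg S,\ \neg T\text{ hold}.\end{cases}$$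
   Context: The means are $$U_{00}=\frac{\beta x-\gamma y-\delta z}{\alpha},\quad U_{01}=\frac{\beta x-\gamma(1-y)-\delta z}{\alpha},\quad U_{10}=\frac{\beta x-\gamma y-\delta(1-z)}{\alpha},\quad U_{11}=\frac{\beta(1-x)-\gamma y-\delta z}{\alpha}.$$ The propositions are \begin{align*} P&:\ (1-2y)\bigl(\beta(2x-1)-\delta(2z-1)\bigr)\le0,\\ Q&:\ (1-2z)\bigl(\beta(2x-1)-\gamma(2y-1)\bigr)\le0,\\ R&:\ (1-2z)\bigl(\beta(2x-1)+\gamma(2y-1)\bigr)\le0,\\ S&:\ (1-2y)\bigl(\beta(2x-1)+\delta(2z-1)\bigr)\le0,\\ T&:\ (2x-1)\bigl(\gamma(1-2y)+\delta(1-2z)\bigr)\le0,\\ V&:\ (2x-1)\bigl(\gamma(2y-1)+\delta(1-2z)\bigr)\le0, \end{align*} and $\neg$ denotes negation. Here $\sin^{c}(t)$ denotes $(\sin t)^c$. *)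

theory Defs
  imports Complex_Main
begin

definition U00 :: "real \<Rightarrow> real \<Rightarrow> real \<Rightarrow> real \<Rightarrow> real \<Rightarrow> real \<Rightarrow> real \<Rightarrow> real" where
  "U00 \<alpha> \<beta> \<gamma> \<delta> x y z = (\<beta> * x - \<gamma> * y - \<delta> * z) / \<alpha>"

definition U01 :: "real \<Rightarrow> real \<Rightarrow> real \<Rightarrow> real \<Rightarrow> real \<Rightarrow> real \<Rightarrow> real \<Rightarrow> real" where
  "U01 \<alpha> \<beta> \<gamma> \<delta> x y z = (\<beta> * x - \<gamma> * (1 - y) - \<delta> * z) / \<alpha>"

definition U10 :: "real \<Rightarrow> real \<Rightarrow> real \<Rightarrow> real \<Rightarrow> real \<Rightarrow> real \<Rightarrow> real \<Rightarrow> real" where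
  "U10 \<alpha> \<beta> \<gamma> \<delta> x y z = (\<beta> * x - \<gamma> * y - \<delta> * (1 - z)) / \<alpha>"

(* The index 11 means that x, and not both y and z, is replaced by its complement. *)
definition U11 :: "real \<Rightarrow> real \<Rightarrow> real \<Rightarrow> real \<Rightarrow> real \<Rightarrow> real \<Rightarrow> real \<Rightarrow> real" where
  "U11 \<alpha> \<beta> \<gamma> \<delta> x y z = (\<beta> * (1 - x) - \<gamma> * y - \<delta> * z) / \<alpha>"

(* The six propositions take the same argument list, although T and V do not depend on \<beta>,
   P and S do not depend on \<gamma>, and Q and R do not depend on \<delta>. *)

definition prop_P :: "real \<Rightarrow> real \<Rightarrow> real \<Rightarrow> real \<Rightarrow> real \<Rightarrow> real \<Rightarrow> bool" where
  "prop_P \<beta> \<gamma> \<delta> x y z \<longleftrightarrow> (1 - 2 * y) * (\<beta> * (2 * x - 1) - \<delta> * (2 * z - 1)) \<le> 0"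

definition prop_Q :: "real \<Rightarrow> real \<Rightarrow> real \<Rightarrow> real \<Rightarrow> real \<Rightarrow> real \<Rightarrow> bool" where
  "prop_Q \<beta> \<gamma> \<delta> x y z \<longleftrightarrow> (1 - 2 * z) * (\<beta> * (2 * x - 1) - \<gamma> * (2 * y - 1)) \<le> 0"

definition prop_R :: "real \<Rightarrow> real \<Rightarrow> real \<Rightarrow> real \<Rightarrow> real \<Rightarrow> real \<Rightarrow> bool" where
  "prop_R \<beta> \<gamma> \<delta> x y z \<longleftrightarrow> (1 - 2 * z) * (\<beta> * (2 * x - 1) + \<gamma> * (2 * y - 1)) \<le> 0"

definition prop_S :: "real \<Rightarrow> real \<Rightarrow> real \<Rightarrow> real \<Rightarrow> real \<Rightarrow> real \<Rightarrow> bool" where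
  "prop_S \<beta> \<gamma> \<delta> x y z \<longleftrightarrow> (1 - 2 * y) * (\<beta> * (2 * x - 1) + \<delta> * (2 * z - 1)) \<le> 0"

definition prop_T :: "real \<Rightarrow> real \<Rightarrow> real \<Rightarrow> real \<Rightarrow> real \<Rightarrow> real \<Rightarrow> bool" where
  "prop_T \<beta> \<gamma> \<delta> x y z \<longleftrightarrow> (2 * x - 1) * (\<gamma> * (1 - 2 * y) + \<delta> * (1 - 2 * z)) \<le> 0"

definition prop_V :: "real \<Rightarrow> real \<Rightarrow> real \<Rightarrow> real \<Rightarrow> real \<Rightarrow> real \<Rightarrow> bool" where
  "prop_V \<beta> \<gamma> \<delta> x y z \<longleftrightarrow> (2 * x - 1) * (\<gamma> * (2 * y - 1) + \<delta> * (1 - 2 * z)) \<le> 0"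

end

theory Submission
  imports Defs
begin

text \<open>
  With \<open>a = 2x - 1\<close>, \<open>b = 2y - 1\<close>, \<open>c = 2z - 1\<close>, each number \<open>\<alpha> (2U - 1)\<close> is one of
  \<open>\<beta>a - \<gamma>b - \<delta>c\<close>, \<open>\<beta>a + \<gamma>b - \<delta>c\<close>, \<open>\<beta>a - \<gamma>b + \<delta>c\<close>, \<open>-\<beta>a - \<gamma>b - \<delta>c\<close>.
  Since \<open>sin (\<pi>U)\<close> decreases with \<open>(2U - 1)\<^sup>2\<close>, the maximum is attained where the square of this
  number is smallest. The difference of two of the squares factors into a positive constant times
  the left-hand side of one of the six propositions, so these express the six pairwise comparisons.
  The four cases locate the first minimiser in the order 00, 01, 10, 11.
\<close>

text \<open>Shifting by a quarter period turns \<open>sin (pi * t)\<close> into the cosine of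
  \<open>pi / 2 * \<bar>2 * t - 1\<bar>\<close>, and cosine is strictly decreasing on
  \<open>[0, pi]\<close>.\<close>

lemma sin_pi_le_iff:
  fixes u v :: real
  assumes "u \<in> {0<..<1}" "v \<in> {0<..<1}"
  shows "sin (pi * u) \<le> sin (pi * v) \<longleftrightarrow> (2 * v - 1)\<^sup>2 \<le> (2 * u - 1)\<^sup>2"
proof -
  have eq: "sin (pi * t) = cos (pi / 2 * \<bar>2 * t - 1\<bar>)" for t :: real
  proof -
    have "sin (pi * t) = cos (pi / 2 * (2 * t - 1))"
      by (simp add: sin_cos_eq algebra_simps flip: cos_minus[of "pi * t - pi / 2"])
    also have "\<dots> = cos \<bar>pi / 2 * (2 * t - 1)\<bar>"
      by (rule cos_abs_real [symmetric])
    also have "\<bar>pi / 2 * (2 * t - 1)\<bar> = pi / 2 * \<bar>2 * t - 1\<bar>"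
      by (simp add: abs_mult)
    finally show ?thesis .
  qed
  have range: "0 \<le> pi / 2 * \<bar>2 * t - 1\<bar> \<and> pi / 2 * \<bar>2 * t - 1\<bar> \<le> pi" if "t \<in> {0<..<1}" for t :: real
  proof -
    have "\<bar>2 * t - 1\<bar> \<le> 2" using that by auto
    then have "pi / 2 * \<bar>2 * t - 1\<bar> \<le> pi / 2 * 2" by (intro mult_left_mono) auto
    then show ?thesis by simp
  qed
  have "sin (pi * u) \<le> sin (pi * v) \<longleftrightarrow> pi / 2 * \<bar>2 * v - 1\<bar> \<le> pi / 2 * \<bar>2 * u - 1\<bar>"
    unfolding eq using range assms by (intro cos_mono_le_eq) auto
  also have "\<dots> \<longleftrightarrow> (2 * v - 1)\<^sup>2 \<le> (2 * u - 1)\<^sup>2"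
    by (simp add: abs_le_square_iff)
  finally show ?thesis .
qed

text \<open>Both sines are positive, so a positive power preserves and reflects their order. The
  factor \<alpha> inside the squares later clears the denominators of the means.\<close>

lemma sin_pi_powr_le_iff:
  fixes u v \<alpha> :: real
  assumes "u \<in> {0<..<1}" "v \<in> {0<..<1}" "\<alpha> > 0"
  shows "sin (pi * u) powr \<alpha> \<le> sin (pi * v) powr \<alpha>
    \<longleftrightarrow> (\<alpha> * (2 * v - 1))\<^sup>2 \<le> (\<alpha> * (2 * u - 1))\<^sup>2"
proof -
  have "sin (pi * u) > 0" "sin (pi * v) > 0"
    using assms by (auto intro!: sin_gt_zero)
  then have "sin (pi * u) powr \<alpha> \<le> sin (pi * v) powr \<alpha> \<longleftrightarrow> sin (pi * u) \<le> sin (pi * v)"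
    using \<open>\<alpha> > 0\<close> by (smt (verit) powr_less_mono2 powr_mono2)
  then show ?thesis
    using assms by (simp add: sin_pi_le_iff power_mult_distrib)
qed

lemma square_le_square_iff_mult_le:
  fixes v w k e :: real
  assumes "v\<^sup>2 - w\<^sup>2 = k * e" "k > 0"
  shows "v\<^sup>2 \<le> w\<^sup>2 \<longleftrightarrow> e \<le> 0"
proof -
  have "v\<^sup>2 \<le> w\<^sup>2 \<longleftrightarrow> k * e \<le> 0" using assms(1) by linarith
  then show ?thesis using \<open>k > 0\<close> by (simp add: mult_le_0_iff)
qed

lemma Max_four_eq_iff:
  fixes a b c d m :: "'a :: linorder"
  assumes "m \<in> {a, b, c, d}"
  shows "Max {a, b, c, d} = m \<longleftrightarrow> a \<le> m \<and> b \<le> m \<and> c \<le> m \<and> d \<le> m"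
  using assms by (subst Max_eq_iff) auto

theorem theorem4p2:
  fixes \<alpha> \<beta> \<gamma> \<delta> x y z :: real
  assumes "\<beta> > 0" and "\<gamma> > 0" and "\<delta> > 0"
    and "\<beta> > \<gamma> + \<delta>"
    and "\<alpha> = \<beta> - \<gamma> - \<delta>"
    and "x \<in> {0<..<1}" and "y \<in> {0<..<1}" and "z \<in> {0<..<1}"
    and "U00 \<alpha> \<beta> \<gamma> \<delta> x y z \<in> {0<..<1}"
    and "U01 \<alpha> \<beta> \<gamma> \<delta> x y z \<in> {0<..<1}"
    and "U10 \<alpha> \<beta> \<gamma> \<delta> x y z \<in> {0<..<1}"
    and "U11 \<alpha> \<beta> \<gamma> \<delta> x y z \<in> {0<..<1}"
  shows
    "let P = prop_P \<beta> \<gamma> \<delta> x y z; Q = prop_Q \<beta> \<gamma> \<delta> x y z; R = prop_R \<beta> \<gamma> \<delta> x y z;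
         S = prop_S \<beta> \<gamma> \<delta> x y z; T = prop_T \<beta> \<gamma> \<delta> x y z; V = prop_V \<beta> \<gamma> \<delta> x y z;
         s00 = sin (pi * U00 \<alpha> \<beta> \<gamma> \<delta> x y z) powr \<alpha>;
         s01 = sin (pi * U01 \<alpha> \<beta> \<gamma> \<delta> x y z) powr \<alpha>;
         s10 = sin (pi * U10 \<alpha> \<beta> \<gamma> \<delta> x y z) powr \<alpha>;
         s11 = sin (pi * U11 \<alpha> \<beta> \<gamma> \<delta> x y z) powr \<alpha>;
         m = Max {s00, s01, s10, s11}
     in (P \<and> Q \<and> T \<longrightarrow> m = s00) \<and>
        (\<not> P \<and> R \<and> V \<longrightarrow> m = s01) \<and>
        (\<not> Q \<and> S \<and> \<not> V \<longrightarrow> m = s10) \<and>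
        (\<not> R \<and> \<not> S \<and> \<not> T \<longrightarrow> m = s11) \<and>
        (P \<and> Q \<and> T \<or> \<not> P \<and> R \<and> V \<or> \<not> Q \<and> S \<and> \<not> V \<or> \<not> R \<and> \<not> S \<and> \<not> T)"
proof -
  have \<alpha>: "\<alpha> > 0" using assms by simp
  have \<beta>: "\<beta> = \<alpha> + \<gamma> + \<delta>" using assms by simp
  let ?u00 = "U00 \<alpha> \<beta> \<gamma> \<delta> x y z" and ?u01 = "U01 \<alpha> \<beta> \<gamma> \<delta> x y z"
    and ?u10 = "U10 \<alpha> \<beta> \<gamma> \<delta> x y z" and ?u11 = "U11 \<alpha> \<beta> \<gamma> \<delta> x y z"
  define s where "s u = sin (pi * u) powr \<alpha>" for u
  define w where "w u = \<alpha> * (2 * u - 1)" for u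
  have le_iff: "s u \<le> s v \<longleftrightarrow> (w v)\<^sup>2 \<le> (w u)\<^sup>2" if "u \<in> {0<..<1}" "v \<in> {0<..<1}" for u v
    unfolding s_def w_def using that \<alpha> by (rule sin_pi_powr_le_iff)
  \<comment> \<open>Twice the numerator of a mean minus \<alpha> remains; splitting \<alpha> as
    \<beta> - \<gamma> - \<delta> centres each of the three variables at 1/2.\<close>
  have w00: "w ?u00 = \<beta> * (2 * x - 1) - \<gamma> * (2 * y - 1) - \<delta> * (2 * z - 1)"
    and w01: "w ?u01 = \<beta> * (2 * x - 1) + \<gamma> * (2 * y - 1) - \<delta> * (2 * z - 1)"
    and w10: "w ?u10 = \<beta> * (2 * x - 1) - \<gamma> * (2 * y - 1) + \<delta> * (2 * z - 1)"
    and w11: "w ?u11 = - \<beta> * (2 * x - 1) - \<gamma> * (2 * y - 1) - \<delta> * (2 * z - 1)"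
    using \<alpha> unfolding w_def U00_def U01_def U10_def U11_def \<beta>
    by (simp_all add: field_simps)
  note ws = w00 w01 w10 w11
  have P: "prop_P \<beta> \<gamma> \<delta> x y z \<longleftrightarrow> s ?u01 \<le> s ?u00"
    unfolding prop_P_def le_iff[OF assms(10,9)] ws
    \<comment> \<open>Of the sum and the difference of the two \<open>w\<close> values, one is plus
      or minus twice a single term, here the \<gamma> term, and the other is twice a two-term
      expression. Hence \<open>k\<close> is 4 times the coefficient of that single term, here and in
      the next five comparisons.\<close>
    by (rule square_le_square_iff_mult_le[where k = "4 * \<gamma>", symmetric], algebra)
      (use assms in simp)
  have Q: "prop_Q \<beta> \<gamma> \<delta> x y z \<longleftrightarrow> s ?u10 \<le> s ?u00"
    unfolding prop_Q_def le_iff[OF assms(11,9)] ws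
    by (rule square_le_square_iff_mult_le[where k = "4 * \<delta>", symmetric], algebra)
      (use assms in simp)
  have R: "prop_R \<beta> \<gamma> \<delta> x y z \<longleftrightarrow> s ?u11 \<le> s ?u01"
    unfolding prop_R_def le_iff[OF assms(12,10)] ws
    by (rule square_le_square_iff_mult_le[where k = "4 * \<delta>", symmetric], algebra)
      (use assms in simp)
  have S: "prop_S \<beta> \<gamma> \<delta> x y z \<longleftrightarrow> s ?u11 \<le> s ?u10"
    unfolding prop_S_def le_iff[OF assms(12,11)] ws
    by (rule square_le_square_iff_mult_le[where k = "4 * \<gamma>", symmetric], algebra)
      (use assms in simp)
  have T: "prop_T \<beta> \<gamma> \<delta> x y z \<longleftrightarrow> s ?u11 \<le> s ?u00"
    unfolding prop_T_def le_iff[OF assms(12,9)] ws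
    by (rule square_le_square_iff_mult_le[where k = "4 * \<beta>", symmetric], algebra)
      (use assms in simp)
  have V: "prop_V \<beta> \<gamma> \<delta> x y z \<longleftrightarrow> s ?u10 \<le> s ?u01"
    unfolding prop_V_def le_iff[OF assms(11,10)] ws
    by (rule square_le_square_iff_mult_le[where k = "4 * \<beta>", symmetric], algebra)
      (use assms in simp)
  show ?thesis
    unfolding Let_def P Q R S T V s_def[symmetric]
    \<comment> \<open>Without \<open>Max_insert\<close> the maximum is not unfolded into nested
      \<open>max\<close>, so each case becomes four inequalities. That some case applies follows
      from totality of the order on the four values.\<close>
    by (simp add: Max_four_eq_iff del: Max_insert) linarith
qed

end
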